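(* Let $d>4$, let $F_d$ be the free group on generators $a_1,\ldots,a_d$, and let $\mu_d$ be the uniform probability measure on $\{a_1^{\pm1},\ldots,a_d^{\pm1}\}$. Then $(F_d,\mu_d)$ is not algebraically recurrent: there is $n$ such that with positive probability $\mathcal{S}_n\neq F_d$.
   Context: A $\mu$-random walk is $X_n=\zeta_1\cdots\zeta_n$ with $\zeta_i$ i.i.d. of law $\mu$; $\mathcal{S}_n$ denotes the semigroup generated by $\{X_n,X_{n+1},\ldots\}$. $(G,\mu)$ is algebraically recurrent if for every $n$, $\mathcal{S}_n=G$ almost surely. *)

theory Defs
  imports "HOL-Algebra.Group" "HOL-Probability.Probability"
begin

text \<open>A letter (i, b) stands for the generator a_i if b = True and for its inverse
  if b = False.\<close>
type_synonym letter = "nat \<times> bool"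

fun cancel_letter :: "letter \<Rightarrow> letter list \<Rightarrow> letter list" where
  "cancel_letter x [] = [x]"
| "cancel_letter x (y # ys) =
     (if fst x = fst y \<and> snd x \<noteq> snd y then ys else x # y # ys)"

definition reduce_word :: "letter list \<Rightarrow> letter list" where
  "reduce_word ws = foldr cancel_letter ws []"

definition reduced_word :: "letter list \<Rightarrow> bool" where
  "reduced_word ws \<longleftrightarrow>
     (\<forall>i. Suc i < length ws \<longrightarrow>
        \<not> (fst (ws ! i) = fst (ws ! Suc i) \<and> snd (ws ! i) \<noteq> snd (ws ! Suc i)))"

definition free_group :: "nat \<Rightarrow> letter list monoid" where
  "free_group d =
     \<lparr> partial_object.carrier = {ws. reduced_word ws \<and> (\<forall>x \<in> set ws. fst x < d)},
       monoid.mult = (\<lambda>xs ys. reduce_word (xs @ ys)),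
       monoid.one = [] \<rparr>"

definition mu_free :: "nat \<Rightarrow> letter list pmf" where
  "mu_free d = pmf_of_set {[(i, b)] | i b. i < d}"

inductive_set gen_semigroup :: "('a, 'b) monoid_scheme \<Rightarrow> 'a set \<Rightarrow> 'a set"
  for G A where
  gen: "a \<in> A \<Longrightarrow> a \<in> gen_semigroup G A"
| mult: "x \<in> gen_semigroup G A \<Longrightarrow> y \<in> gen_semigroup G A \<Longrightarrow>
           x \<otimes>\<^bsub>G\<^esub> y \<in> gen_semigroup G A"

text \<open>Position X_n = zeta_1 ... zeta_n of the random walk, where the increment
  zeta_(i+1) is \<omega> i.\<close>
definition rw_pos :: "('a, 'b) monoid_scheme \<Rightarrow> (nat \<Rightarrow> 'a) \<Rightarrow> nat \<Rightarrow> 'a" where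
  "rw_pos G \<omega> n = foldl (\<lambda>acc i. acc \<otimes>\<^bsub>G\<^esub> \<omega> i) \<one>\<^bsub>G\<^esub> [0..<n]"

definition rw_space :: "'a pmf \<Rightarrow> (nat \<Rightarrow> 'a) measure" where
  "rw_space \<mu> = Pi\<^sub>M UNIV (\<lambda>_. measure_pmf \<mu>)"

definition rw_tail_semigroup :: "('a, 'b) monoid_scheme \<Rightarrow> (nat \<Rightarrow> 'a) \<Rightarrow> nat \<Rightarrow> 'a set" where
  "rw_tail_semigroup G \<omega> n = gen_semigroup G {rw_pos G \<omega> m | m. n \<le> m}"

definition alg_recurrent :: "('a, 'b) monoid_scheme \<Rightarrow> 'a pmf \<Rightarrow> bool" where
  "alg_recurrent G \<mu> \<longleftrightarrow>
     (\<forall>n\<ge>1. AE \<omega> in rw_space \<mu>. rw_tail_semigroup G \<omega> n = carrier G)"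

end

theory Submission
  imports Defs "HOL-Algebra.Divisibility" "HOL-Library.Sublist"
begin

text \<open>
  Almost surely the identity lies outside the semigroup generated by \<open>X m\<close>, \<open>m \<ge> 64 * n\<close>, once \<open>n\<close>
  is large: a product \<open>X m \<cdot> s\<close> with \<open>s\<close> in this semigroup cancels fewer than \<open>h = m div 64\<close>
  letters of \<open>X m\<close>, while \<open>X m\<close> has length at least \<open>m / 4\<close>.

  Since \<open>d > 4\<close>, the function \<open>3 ^ (- length (g \<cdot> X k))\<close> shrinks on average by the factor \<open>3/5\<close>
  per step. This gives linear escape, and shows that a segment of \<open>k\<close> steps of the walk spells a
  given word of length \<open>h\<close> with probability at most \<open>(3/5) ^ k * 3 ^ (- h)\<close>. If \<open>s\<close> cancels \<open>h\<close>
  letters of \<open>X m\<close>, then a segment of the walk between the times \<open>8 * h\<close> and \<open>m\<close> spells the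
  inverse of the prefix of \<open>s\<close> of length \<open>h\<close>. By induction on the number of factors this prefix
  is already a prefix of a product of positions with indices in \<open>[n, 8 * h]\<close> whose sum is at
  most \<open>16 * h\<close>. These positions are independent of the segment, and for large \<open>n\<close> there are at
  most \<open>2 * 2 ^ h\<close> such products. So the probabilities of these coincidences are summable over
  \<open>m\<close>, and the Borel--Cantelli lemma applies.
\<close>

subsection \<open>Reduced words and the free group\<close>

definition inv_letter :: "letter \<Rightarrow> letter" where
  "inv_letter x = (fst x, \<not> snd x)"

lemma fst_inv_letter [simp]: "fst (inv_letter x) = fst x"
  by (simp add: inv_letter_def)

lemma inv_letter_inv_letter [simp]: "inv_letter (inv_letter x) = x"
  by (simp add: inv_letter_def)

lemma opposite_letter_iff: "fst x = fst y \<and> snd x \<noteq> snd y \<longleftrightarrow> y = inv_letter x"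
  by (cases x; cases y) (auto simp: inv_letter_def)

lemma cancel_letter_Cons:
  "cancel_letter x (y # ys) = (if y = inv_letter x then ys else x # y # ys)"
  by (simp only: cancel_letter.simps opposite_letter_iff)

declare cancel_letter.simps(2) [simp del] cancel_letter_Cons [simp]

lemma reduced_word_iff_successively:
  "reduced_word ws \<longleftrightarrow> successively (\<lambda>x y. y \<noteq> inv_letter x) ws"
  unfolding reduced_word_def opposite_letter_iff successively_conv_nth by simp

lemma reduced_word_simps [simp]:
  "reduced_word []" "reduced_word [x]"
  "reduced_word (x # y # ys) \<longleftrightarrow> y \<noteq> inv_letter x \<and> reduced_word (y # ys)"
  by (simp_all add: reduced_word_iff_successively)

lemma reduced_word_append_iff:
  "reduced_word (xs @ ys) \<longleftrightarrow> reduced_word xs \<and> reduced_word ys \<and>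
     (xs \<noteq> [] \<longrightarrow> ys \<noteq> [] \<longrightarrow> hd ys \<noteq> inv_letter (last xs))"
  by (auto simp: reduced_word_iff_successively successively_append_iff)

lemma reduced_word_ConsD: "reduced_word (x # xs) \<Longrightarrow> reduced_word xs"
  using reduced_word_append_iff[of "[x]" xs] by simp

lemma reduced_word_append_overlap:
  "reduced_word (u @ q) \<Longrightarrow> reduced_word (q @ z) \<Longrightarrow> q \<noteq> [] \<Longrightarrow> reduced_word (u @ q @ z)"
  by (auto simp: reduced_word_append_iff)

lemma reduced_word_cancel_letter: "reduced_word ys \<Longrightarrow> reduced_word (cancel_letter x ys)"
  by (cases ys) (auto dest: reduced_word_ConsD)

lemma reduced_word_foldr_cancel_letter:
  "reduced_word ys \<Longrightarrow> reduced_word (foldr cancel_letter xs ys)"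
  by (induction xs) (auto intro: reduced_word_cancel_letter)

lemma reduced_word_reduce_word [simp]: "reduced_word (reduce_word ws)"
  by (simp add: reduce_word_def reduced_word_foldr_cancel_letter)

lemma set_cancel_letter_subset: "set (cancel_letter x ys) \<subseteq> insert x (set ys)"
  by (cases ys) auto

lemma set_reduce_word_subset: "set (reduce_word ws) \<subseteq> set ws"
proof (induction ws)
  case (Cons x ws)
  then show ?case
    using set_cancel_letter_subset[of x "reduce_word ws"] by (auto simp: reduce_word_def)
qed (simp add: reduce_word_def)

lemma reduce_word_eq_self: "reduced_word ws \<Longrightarrow> reduce_word ws = ws"
proof (induction ws)
  case (Cons x ws)
  then have "reduce_word ws = ws" by (auto dest: reduced_word_ConsD)
  with Cons.prems show ?case by (cases ws) (auto simp: reduce_word_def)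
qed (simp add: reduce_word_def)

lemma cancel_letter_cancel_letter_inv:
  assumes "reduced_word ys"
  shows "cancel_letter x (cancel_letter (inv_letter x) ys) = ys"
proof (cases ys)
  case (Cons y zs)
  with assms show ?thesis by (cases zs) auto
qed simp

lemma foldr_cancel_letter_reduce_word:
  assumes "reduced_word ys"
  shows "foldr cancel_letter (reduce_word xs) ys = foldr cancel_letter xs ys"
proof (induction xs)
  case (Cons x xs)
  have "foldr cancel_letter (cancel_letter x zs) ys = cancel_letter x (foldr cancel_letter zs ys)"
    for zs
    by (cases zs)
      (auto simp: cancel_letter_cancel_letter_inv reduced_word_foldr_cancel_letter assms)
  with Cons show ?case by (simp add: reduce_word_def)
qed (simp add: reduce_word_def)

definition word_mult :: "letter list \<Rightarrow> letter list \<Rightarrow> letter list" (infixl "\<odot>" 70) where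
  "xs \<odot> ys = reduce_word (xs @ ys)"

lemma reduced_word_mult [simp]: "reduced_word (xs \<odot> ys)"
  by (simp add: word_mult_def)

lemma word_mult_eq_append: "reduced_word (xs @ ys) \<Longrightarrow> xs \<odot> ys = xs @ ys"
  by (simp add: word_mult_def reduce_word_eq_self)

lemma word_mult_Nil_left: "reduced_word xs \<Longrightarrow> [] \<odot> xs = xs"
  and word_mult_Nil_right: "reduced_word xs \<Longrightarrow> xs \<odot> [] = xs"
  by (simp_all add: word_mult_eq_append)

lemma word_mult_eq_foldr: "reduced_word ys \<Longrightarrow> xs \<odot> ys = foldr cancel_letter xs ys"
  using reduce_word_eq_self[of ys] by (simp add: word_mult_def reduce_word_def)

lemma word_mult_assoc: "(xs \<odot> ys) \<odot> zs = xs \<odot> (ys \<odot> zs)"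
proof -
  have "(xs \<odot> ys) \<odot> zs = foldr cancel_letter (reduce_word (xs @ ys)) (reduce_word zs)"
    by (simp add: word_mult_def reduce_word_def)
  also have "\<dots> = foldr cancel_letter xs (ys \<odot> zs)"
    by (subst foldr_cancel_letter_reduce_word[OF reduced_word_reduce_word])
       (simp add: word_mult_def reduce_word_def)
  finally show ?thesis by (simp add: word_mult_eq_foldr)
qed

definition word_inv :: "letter list \<Rightarrow> letter list" where
  "word_inv xs = rev (map inv_letter xs)"

lemma word_inv_simps [simp]:
  "word_inv [] = []" "word_inv (x # xs) = word_inv xs @ [inv_letter x]"
  "word_inv (xs @ ys) = word_inv ys @ word_inv xs"
  "length (word_inv xs) = length xs" "set (word_inv xs) = inv_letter ` set xs"
  by (simp_all add: word_inv_def)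

lemma reduced_word_inv_iff [simp]: "reduced_word (word_inv xs) \<longleftrightarrow> reduced_word xs"
  by (auto simp: word_inv_def reduced_word_iff_successively successively_map
      elim!: successively_mono)

lemma word_inv_mult_append:
  assumes "reduced_word (xs @ ys)"
  shows "word_inv xs \<odot> (xs @ ys) = ys"
  using assms
proof (induction xs)
  case (Cons x xs)
  then have "reduced_word (x # xs @ ys)" "reduced_word (xs @ ys)"
    by (auto dest: reduced_word_ConsD)
  moreover have "cancel_letter (inv_letter x) (x # xs @ ys) = xs @ ys" by simp
  ultimately show ?case using Cons.IH by (simp add: word_mult_eq_foldr)
qed (simp add: word_mult_Nil_left)

lemma word_inv_mult_self: "reduced_word xs \<Longrightarrow> word_inv xs \<odot> xs = []"
  using word_inv_mult_append[of xs "[]"] by simp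

lemma mult_free_group [simp]: "x \<otimes>\<^bsub>free_group d\<^esub> y = x \<odot> y"
  by (simp add: free_group_def word_mult_def)

lemma one_free_group [simp]: "\<one>\<^bsub>free_group d\<^esub> = []"
  by (simp add: free_group_def)

lemma carrier_free_group_iff:
  "x \<in> carrier (free_group d) \<longleftrightarrow> reduced_word x \<and> (\<forall>a\<in>set x. fst a < d)"
  by (simp add: free_group_def)

lemma group_free_group: "group (free_group d)"
proof (rule groupI)
  fix x y z assume x: "x \<in> carrier (free_group d)"
  show "x \<otimes>\<^bsub>free_group d\<^esub> y \<in> carrier (free_group d)" if "y \<in> carrier (free_group d)"
    using x that set_reduce_word_subset[of "x @ y"]
    by (auto simp: carrier_free_group_iff word_mult_def)
  show "x \<otimes>\<^bsub>free_group d\<^esub> y \<otimes>\<^bsub>free_group d\<^esub> z = x \<otimes>\<^bsub>free_group d\<^esub> (y \<otimes>\<^bsub>free_group d\<^esub> z)"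
    by (simp add: word_mult_assoc)
  show "\<one>\<^bsub>free_group d\<^esub> \<otimes>\<^bsub>free_group d\<^esub> x = x"
    using x by (simp add: carrier_free_group_iff word_mult_Nil_left)
  have "word_inv x \<in> carrier (free_group d)"
    using x by (auto simp: carrier_free_group_iff)
  moreover have "word_inv x \<odot> x = []"
    using x by (simp add: carrier_free_group_iff word_inv_mult_self)
  ultimately show "\<exists>y\<in>carrier (free_group d). y \<otimes>\<^bsub>free_group d\<^esub> x = \<one>\<^bsub>free_group d\<^esub>" by auto
qed (simp add: carrier_free_group_iff)

lemma word_mult_cancel_middle:
  assumes "reduced_word (u @ word_inv v)" "reduced_word (v @ w)" "reduced_word (u @ w)"
  shows "(u @ word_inv v) \<odot> (v @ w) = u @ w"
proof -
  have "(u @ word_inv v) \<odot> (v @ w) = (u \<odot> word_inv v) \<odot> (v @ w)"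
    by (simp add: word_mult_eq_append assms(1))
  also have "\<dots> = u \<odot> (word_inv v \<odot> (v @ w))"
    by (rule word_mult_assoc)
  also have "\<dots> = u @ w"
    by (simp add: word_inv_mult_append word_mult_eq_append assms(2,3))
  finally show ?thesis .
qed

lemma word_mult_cancellation:
  assumes "reduced_word x" "reduced_word y"
  obtains u v w where "x = u @ word_inv v" "y = v @ w" "x \<odot> y = u @ w"
proof -
  have "\<exists>u v w. x = u @ word_inv v \<and> y = v @ w \<and> reduced_word (u @ w)"
    using assms
  proof (induction x arbitrary: y rule: rev_induct)
    case (snoc a x)
    show ?case
    proof (cases "y \<noteq> [] \<and> hd y = inv_letter a")
      case True
      then obtain y' where y: "y = inv_letter a # y'" by (cases y) auto
      then obtain u v w where "x = u @ word_inv v" "y' = v @ w" "reduced_word (u @ w)"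
        using snoc.IH[of y'] snoc.prems
        by (metis reduced_word_ConsD reduced_word_append_iff)
      then have "x @ [a] = u @ word_inv (inv_letter a # v) \<and> y = (inv_letter a # v) @ w
                   \<and> reduced_word (u @ w)"
        by (simp add: y)
      then show ?thesis by blast
    next
      case False
      then have "reduced_word ((x @ [a]) @ y)"
        using snoc.prems by (subst reduced_word_append_iff) auto
      then show ?thesis by (intro exI[of _ "x @ [a]"] exI[of _ "[]"] exI[of _ y]) auto
    qed
  qed (auto intro: exI[of _ "[]"])
  then show ?thesis using that assms word_mult_cancel_middle by blast
qed

lemma word_mult_letter_cases:
  assumes "reduced_word x"
  obtains "x \<odot> [a] = x @ [a]" | "x = (x \<odot> [a]) @ [inv_letter a]"
proof -
  obtain u v w where uvw: "x = u @ word_inv v" "[a] = v @ w" "x \<odot> [a] = u @ w"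
    by (rule word_mult_cancellation[OF assms, of "[a]"]) auto
  then show ?thesis using that by (cases v) auto
qed

lemma prefix_word_mult_cancel:
  assumes "reduced_word (u @ word_inv v)" "reduced_word (u @ q)" "q \<noteq> []"
    and "reduced_word y" "prefix (v @ q) y"
  shows "prefix (u @ q) ((u @ word_inv v) \<odot> y)"
proof -
  obtain z where y: "y = v @ q @ z" using assms(5) by (auto simp: prefix_def)
  then have "reduced_word (u @ q @ z)"
    using reduced_word_append_overlap assms by (metis reduced_word_append_iff)
  then have "(u @ word_inv v) \<odot> y = u @ q @ z"
    using word_mult_cancel_middle assms(1,4) y by blast
  then show ?thesis by simp
qed

subsection \<open>Random walks on monoids\<close>

definition shift_seq :: "nat \<Rightarrow> (nat \<Rightarrow> 'a) \<Rightarrow> nat \<Rightarrow> 'a" where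
  "shift_seq i \<omega> = (\<lambda>j. \<omega> (i + j))"

lemma shift_seq_0 [simp]: "shift_seq 0 \<omega> = \<omega>"
  by (simp add: shift_seq_def)

lemma shift_seq_comb_seq [simp]: "shift_seq i (comb_seq i \<omega> \<omega>') = \<omega>'"
  by (simp add: shift_seq_def comb_seq_def)

lemma rw_pos_0 [simp]: "rw_pos G \<omega> 0 = \<one>\<^bsub>G\<^esub>"
  and rw_pos_Suc: "rw_pos G \<omega> (Suc n) = rw_pos G \<omega> n \<otimes>\<^bsub>G\<^esub> \<omega> n"
  by (simp_all add: rw_pos_def)

lemma rw_pos_comb_seq: "n \<le> i \<Longrightarrow> rw_pos G (comb_seq i \<omega> \<omega>') n = rw_pos G \<omega> n"
  by (induction n) (simp_all add: rw_pos_Suc comb_seq_less)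

definition rw_prod :: "('a, 'b) monoid_scheme \<Rightarrow> (nat \<Rightarrow> 'a) \<Rightarrow> nat list \<Rightarrow> 'a" where
  "rw_prod G \<omega> ms = foldr (\<otimes>\<^bsub>G\<^esub>) (map (rw_pos G \<omega>) ms) \<one>\<^bsub>G\<^esub>"

lemma rw_prod_simps [simp]:
  "rw_prod G \<omega> [] = \<one>\<^bsub>G\<^esub>"
  "rw_prod G \<omega> (m # ms) = rw_pos G \<omega> m \<otimes>\<^bsub>G\<^esub> rw_prod G \<omega> ms"
  by (simp_all add: rw_prod_def)

lemma rw_prod_comb_seq:
  "set ms \<subseteq> {..i} \<Longrightarrow> rw_prod G (comb_seq i \<omega> \<omega>') ms = rw_prod G \<omega> ms"
  by (induction ms) (simp_all add: rw_pos_comb_seq)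

context monoid
begin

lemma rw_pos_closed: "(\<And>i. \<omega> i \<in> carrier G) \<Longrightarrow> rw_pos G \<omega> n \<in> carrier G"
  by (induction n) (simp_all add: rw_pos_Suc)

lemma rw_pos_add:
  assumes "\<And>i. \<omega> i \<in> carrier G"
  shows "rw_pos G \<omega> (i + k) = rw_pos G \<omega> i \<otimes> rw_pos G (shift_seq i \<omega>) k"
proof (induction k)
  case (Suc k)
  have "rw_pos G (shift_seq i \<omega>) k \<in> carrier G"
    using assms by (intro rw_pos_closed) (simp add: shift_seq_def)
  with Suc show ?case
    using assms rw_pos_closed[of \<omega> i, OF assms] by (simp add: rw_pos_Suc m_assoc shift_seq_def)
qed (simp add: assms rw_pos_closed)

lemma foldr_mult_append:
  assumes "set xs \<subseteq> carrier G" "set ys \<subseteq> carrier G"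
  shows "foldr (\<otimes>) (xs @ ys) \<one> = foldr (\<otimes>) xs \<one> \<otimes> foldr (\<otimes>) ys \<one>"
  using assms by (induction xs) (simp_all add: m_assoc multlist_closed)

lemma gen_semigroup_eq_foldr_mult:
  assumes "A \<subseteq> carrier G"
  shows "gen_semigroup G A = {foldr (\<otimes>) xs \<one> | xs. xs \<noteq> [] \<and> set xs \<subseteq> A}"
proof (intro subset_antisym subsetI)
  fix x assume "x \<in> gen_semigroup G A"
  then have "\<exists>xs. x = foldr (\<otimes>) xs \<one> \<and> xs \<noteq> [] \<and> set xs \<subseteq> A"
  proof (induction rule: gen_semigroup.induct)
    case (gen a)
    then show ?case using assms by (intro exI[of _ "[a]"]) auto
  next
    case (mult x y)
    then obtain xs ys where "x = foldr (\<otimes>) xs \<one>" "xs \<noteq> []" "set xs \<subseteq> A"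
      and "y = foldr (\<otimes>) ys \<one>" "ys \<noteq> []" "set ys \<subseteq> A" by blast
    with assms show ?case
      using foldr_mult_append[of xs ys] by (intro exI[of _ "xs @ ys"]) auto
  qed
  then show "x \<in> {foldr (\<otimes>) xs \<one> | xs. xs \<noteq> [] \<and> set xs \<subseteq> A}" by blast
next
  have "foldr (\<otimes>) xs \<one> \<in> gen_semigroup G A" if "xs \<noteq> []" "set xs \<subseteq> A" for xs
    using that
  proof (induction xs rule: list_nonempty_induct)
    case (single x)
    then have "x \<in> A" by simp
    with assms show ?case by (auto simp: subset_iff intro: gen_semigroup.gen)
  qed (auto intro: gen_semigroup.intros)
  then show "x \<in> gen_semigroup G A"
    if "x \<in> {foldr (\<otimes>) xs \<one> | xs. xs \<noteq> [] \<and> set xs \<subseteq> A}" for x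
    using that by blast
qed

lemma rw_tail_semigroup_eq_rw_prod:
  assumes "\<And>i. \<omega> i \<in> carrier G"
  shows "rw_tail_semigroup G \<omega> n = {rw_prod G \<omega> ms | ms. ms \<noteq> [] \<and> set ms \<subseteq> {n..}}"
proof -
  have "{rw_pos G \<omega> m | m. n \<le> m} = rw_pos G \<omega> ` {n..}" by auto
  moreover have "xs \<noteq> [] \<and> set xs \<subseteq> rw_pos G \<omega> ` {n..} \<longleftrightarrow>
      (\<exists>ms. xs = map (rw_pos G \<omega>) ms \<and> ms \<noteq> [] \<and> set ms \<subseteq> {n..})" for xs
    using lists_image[of "rw_pos G \<omega>" "{n..}"] by (auto simp: lists_eq_set set_eq_iff)
  moreover have "rw_pos G \<omega> ` {n..} \<subseteq> carrier G" using rw_pos_closed[OF assms] by auto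
  ultimately show ?thesis
    unfolding rw_tail_semigroup_def rw_prod_def by (auto simp: gen_semigroup_eq_foldr_mult)
qed

end

subsection \<open>The probability space of increments\<close>

lemma space_rw_space [simp]: "space (rw_space \<mu>) = UNIV"
  by (simp add: rw_space_def space_PiM)

interpretation rw_space: prob_space "rw_space \<mu>" for \<mu> :: "'a pmf"
  unfolding rw_space_def by (intro prob_space_PiM prob_space_measure_pmf)

lemma measurable_coordinate [measurable]:
  "(\<lambda>\<omega>. \<omega> i) \<in> measurable (rw_space \<mu>) (count_space UNIV)"
proof -
  have "(\<lambda>\<omega>. \<omega> i) \<in> measurable (rw_space \<mu>) (measure_pmf \<mu>)"
    unfolding rw_space_def by (rule measurable_component_singleton) simp
  then show ?thesis by (simp cong: measurable_cong_sets)
qed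

lemma nn_integral_coordinate: "(\<integral>\<^sup>+\<omega>. f (\<omega> i) \<partial>rw_space \<mu>) = (\<integral>\<^sup>+z. f z \<partial>measure_pmf \<mu>)"
proof -
  have "(\<integral>\<^sup>+z. f z \<partial>measure_pmf \<mu>) = (\<integral>\<^sup>+z. f z \<partial>distr (rw_space \<mu>) (measure_pmf \<mu>) (\<lambda>\<omega>. \<omega> i))"
    unfolding rw_space_def by (subst distr_PiM_component) (auto intro: prob_space_measure_pmf)
  also have "\<dots> = (\<integral>\<^sup>+\<omega>. f (\<omega> i) \<partial>rw_space \<mu>)"
    by (rule nn_integral_distr) (simp_all add: measurable_coordinate)
  finally show ?thesis by simp
qed

lemma AE_rw_space_set_pmf: "AE \<omega> in rw_space \<mu>. \<forall>i. \<omega> i \<in> set_pmf \<mu>"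
proof -
  have "AE \<omega> in rw_space \<mu>. \<omega> i \<in> set_pmf \<mu>" for i
    unfolding rw_space_def
    by (rule AE_PiM_component) (auto intro: prob_space_measure_pmf AE_measure_pmf)
  then show ?thesis by (simp add: AE_all_countable)
qed

lemma measurable_comb_seq_right:
  "(\<lambda>\<omega>'. comb_seq i \<omega> \<omega>') \<in> measurable (rw_space \<mu>) (rw_space \<mu>)"
  unfolding rw_space_def by (rule measurable_comb_seq') (simp_all add: space_PiM)

lemma nn_integral_rw_space_comb_seq:
  assumes "f \<in> borel_measurable (rw_space \<mu>)"
  shows "(\<integral>\<^sup>+\<omega>. f \<omega> \<partial>rw_space \<mu>) =
    (\<integral>\<^sup>+\<omega>. \<integral>\<^sup>+\<omega>'. f (comb_seq i \<omega> \<omega>') \<partial>rw_space \<mu> \<partial>rw_space \<mu>)"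
proof -
  interpret sequence_space "measure_pmf \<mu>" by unfold_locales
  have S: "rw_space \<mu> = S" by (simp add: rw_space_def)
  have f: "f \<in> borel_measurable S" using assms by (simp add: S)
  have "(\<integral>\<^sup>+\<omega>. f \<omega> \<partial>S) = (\<integral>\<^sup>+\<omega>. f \<omega> \<partial>distr (S \<Otimes>\<^sub>M S) S (\<lambda>(\<omega>, \<omega>'). comb_seq i \<omega> \<omega>'))"
    by (simp only: PiM_comb_seq)
  also have "\<dots> = (\<integral>\<^sup>+x. f (case x of (\<omega>, \<omega>') \<Rightarrow> comb_seq i \<omega> \<omega>') \<partial>(S \<Otimes>\<^sub>M S))"
    using f by (intro nn_integral_distr measurable_comb_seq) simp
  also have "\<dots> = (\<integral>\<^sup>+\<omega>. \<integral>\<^sup>+\<omega>'. f (comb_seq i \<omega> \<omega>') \<partial>S \<partial>S)"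
    using f measurable_compose[OF measurable_comb_seq f]
    by (subst P.nn_integral_fst[symmetric]) auto
  finally show ?thesis by (simp add: S)
qed

lemma emeasure_shift_le:
  assumes "{\<omega>. Q \<omega> (shift_seq i \<omega>)} \<in> sets (rw_space \<mu>)"
    and past: "\<And>\<omega> \<omega>'. Q (comb_seq i \<omega> \<omega>') = Q \<omega>"
    and le: "\<And>\<omega>. emeasure (rw_space \<mu>) {\<omega>'. Q \<omega> \<omega>'} \<le> b"
  shows "emeasure (rw_space \<mu>) {\<omega>. Q \<omega> (shift_seq i \<omega>)} \<le> b"
proof -
  let ?A = "{\<omega>. Q \<omega> (shift_seq i \<omega>)}"
  have slice: "comb_seq i \<omega> -` ?A = {\<omega>'. Q \<omega> \<omega>'}" for \<omega>
    by (auto simp: past)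
  have "emeasure (rw_space \<mu>) ?A = (\<integral>\<^sup>+\<omega>. indicator ?A \<omega> \<partial>rw_space \<mu>)"
    using assms(1) by simp
  also have "\<dots> = (\<integral>\<^sup>+\<omega>. \<integral>\<^sup>+\<omega>'. indicator ?A (comb_seq i \<omega> \<omega>') \<partial>rw_space \<mu> \<partial>rw_space \<mu>)"
    using assms(1) by (intro nn_integral_rw_space_comb_seq) simp
  also have "\<dots> = (\<integral>\<^sup>+\<omega>. emeasure (rw_space \<mu>) {\<omega>'. Q \<omega> \<omega>'} \<partial>rw_space \<mu>)"
    using measurable_sets[OF measurable_comb_seq_right assms(1), of i]
    by (simp flip: slice indicator_vimage)
  also have "\<dots> \<le> (\<integral>\<^sup>+\<omega>. b \<partial>rw_space \<mu>)" by (intro nn_integral_mono le)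
  also have "\<dots> = b" using rw_space.emeasure_space_1[of \<mu>] by simp
  finally show ?thesis .
qed

lemma measurable_count_space_binop:
  fixes f :: "'m \<Rightarrow> 'a::countable"
  assumes "f \<in> measurable M (count_space UNIV)" "g \<in> measurable M (count_space UNIV)"
  shows "(\<lambda>x. h (f x) (g x)) \<in> measurable M (count_space UNIV)"
  by (rule measurable_compose_countable[where f = "\<lambda>a x. h a (g x)" and g = f])
     (auto intro: assms measurable_compose[OF assms(2)])

lemma measurable_rw_pos_shift [measurable]:
  fixes G :: "('a::countable, 'b) monoid_scheme"
  shows "(\<lambda>\<omega>. rw_pos G (shift_seq i \<omega>) k) \<in> measurable (rw_space \<mu>) (count_space UNIV)"
  by (induction k)
     (auto simp: rw_pos_Suc shift_seq_def intro: measurable_count_space_binop measurable_coordinate)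

lemma measurable_rw_pos [measurable]:
  fixes G :: "('a::countable, 'b) monoid_scheme"
  shows "(\<lambda>\<omega>. rw_pos G \<omega> k) \<in> measurable (rw_space \<mu>) (count_space UNIV)"
  using measurable_rw_pos_shift[of G 0 k \<mu>] by simp

lemma measurable_rw_prod [measurable]:
  fixes G :: "('a::countable, 'b) monoid_scheme"
  shows "(\<lambda>\<omega>. rw_prod G \<omega> ms) \<in> measurable (rw_space \<mu>) (count_space UNIV)"
  by (induction ms) (auto intro: measurable_count_space_binop measurable_rw_pos)

lemma nn_integral_rw_pos_le_power:
  fixes G :: "('a::countable, 'b) monoid_scheme" (structure) and f :: "'a \<Rightarrow> ennreal"
  assumes "monoid G" "set_pmf \<mu> \<subseteq> carrier G"
    and step: "\<And>x. x \<in> carrier G \<Longrightarrow> (\<integral>\<^sup>+z. f (x \<otimes> z) \<partial>measure_pmf \<mu>) \<le> c * f x"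
  shows "(\<integral>\<^sup>+\<omega>. f (rw_pos G \<omega> k) \<partial>rw_space \<mu>) \<le> c ^ k * f \<one>"
proof (induction k)
  case 0
  show ?case using rw_space.emeasure_space_1[of \<mu>] by simp
next
  case (Suc k)
  interpret monoid G by fact
  have meas: "(\<lambda>\<omega>. f (rw_pos G \<omega> n)) \<in> borel_measurable (rw_space \<mu>)" for n
    by (rule measurable_compose[OF measurable_rw_pos]) simp
  have "(\<integral>\<^sup>+\<omega>. f (rw_pos G \<omega> (Suc k)) \<partial>rw_space \<mu>)
      = (\<integral>\<^sup>+\<omega>. \<integral>\<^sup>+\<omega>'. f (rw_pos G \<omega> k \<otimes> \<omega>' 0) \<partial>rw_space \<mu> \<partial>rw_space \<mu>)"
    by (subst nn_integral_rw_space_comb_seq[OF meas, of _ k])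
       (simp add: rw_pos_Suc rw_pos_comb_seq comb_seq_def)
  also have "\<dots> = (\<integral>\<^sup>+\<omega>. \<integral>\<^sup>+z. f (rw_pos G \<omega> k \<otimes> z) \<partial>measure_pmf \<mu> \<partial>rw_space \<mu>)"
    by (subst nn_integral_coordinate) (rule refl)
  also have "\<dots> \<le> (\<integral>\<^sup>+\<omega>. c * f (rw_pos G \<omega> k) \<partial>rw_space \<mu>)"
  proof (rule nn_integral_mono_AE)
    show "AE \<omega> in rw_space \<mu>.
        (\<integral>\<^sup>+z. f (rw_pos G \<omega> k \<otimes> z) \<partial>measure_pmf \<mu>) \<le> c * f (rw_pos G \<omega> k)"
      using AE_rw_space_set_pmf[of \<mu>]
    proof eventually_elim
      case (elim \<omega>)
      with assms(2) show ?case by (intro step rw_pos_closed) blast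
    qed
  qed
  also have "\<dots> = c * (\<integral>\<^sup>+\<omega>. f (rw_pos G \<omega> k) \<partial>rw_space \<mu>)"
    by (rule nn_integral_cmult[OF meas])
  also have "\<dots> \<le> c ^ Suc k * f \<one>"
    using mult_left_mono[OF Suc, of c] by (simp add: mult.assoc)
  finally show ?case .
qed

lemma reduced_rw_pos [simp]: "reduced_word (rw_pos (free_group d) \<omega> n)"
  by (cases n) (simp_all add: rw_pos_Suc)

lemma reduced_rw_prod [simp]: "reduced_word (rw_prod (free_group d) \<omega> ms)"
  by (cases ms) simp_all

subsection \<open>Lists of bounded sum\<close>

definition bounded_sum_lists :: "nat \<Rightarrow> nat \<Rightarrow> nat list set" where
  "bounded_sum_lists n M = {ms. set ms \<subseteq> {n..} \<and> sum_list ms \<le> M}"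

lemma bounded_sum_lists_antimono: "n \<le> n' \<Longrightarrow> bounded_sum_lists n' M \<subseteq> bounded_sum_lists n M"
  by (auto simp: bounded_sum_lists_def)

lemma bounded_sum_lists_subset_Cons:
  "bounded_sum_lists n M \<subseteq> insert [] (\<Union>x\<in>{n..M}. (#) x ` bounded_sum_lists n (M - x))"
proof
  fix ms assume "ms \<in> bounded_sum_lists n M"
  then show "ms \<in> insert [] (\<Union>x\<in>{n..M}. (#) x ` bounded_sum_lists n (M - x))"
    by (cases ms) (auto simp: bounded_sum_lists_def image_iff intro!: bexI[of _ "hd ms"])
qed

lemma finite_bounded_sum_lists:
  assumes "1 \<le> n"
  shows "finite (bounded_sum_lists n M)"
proof (induction M rule: less_induct)
  case (less M)
  have "finite (bounded_sum_lists n (M - x))" if "x \<in> {n..M}" for x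
    using less[of "M - x"] that assms by simp
  then have "finite (insert [] (\<Union>x\<in>{n..M}. (#) x ` bounded_sum_lists n (M - x)))" by simp
  then show ?case by (rule finite_subset[OF bounded_sum_lists_subset_Cons])
qed

lemma card_bounded_sum_lists_le_sum:
  assumes "1 \<le> n"
  shows "card (bounded_sum_lists n M) \<le> 1 + (\<Sum>x=n..M. card (bounded_sum_lists n (M - x)))"
proof -
  let ?U = "\<Union>x\<in>{n..M}. (#) x ` bounded_sum_lists n (M - x)"
  have fin: "finite ?U" by (intro finite_UN_I finite_imageI finite_bounded_sum_lists assms) simp
  have "card (bounded_sum_lists n M) \<le> card (insert [] ?U)"
    using bounded_sum_lists_subset_Cons fin by (intro card_mono) auto
  also have "\<dots> \<le> 1 + card ?U" using fin by (simp add: card_insert_if)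
  also have "card ?U \<le> (\<Sum>x=n..M. card ((#) x ` bounded_sum_lists n (M - x)))"
    by (rule card_UN_le) simp
  also have "\<dots> = (\<Sum>x=n..M. card (bounded_sum_lists n (M - x)))"
    by (intro sum.cong card_image) auto
  finally show ?thesis by simp
qed

lemma card_bounded_sum_lists_le:
  fixes c :: real
  assumes "1 \<le> n" "1 < c" and tail: "\<And>M. (\<Sum>x=n..M. inverse c ^ x) \<le> 1 / 2"
  shows "card (bounded_sum_lists n M) \<le> 2 * c ^ M"
proof (induction M rule: less_induct)
  case (less M)
  have "real (card (bounded_sum_lists n M))
      \<le> real (1 + (\<Sum>x=n..M. card (bounded_sum_lists n (M - x))))"
    using card_bounded_sum_lists_le_sum[OF assms(1)] of_nat_mono by blast
  also have "\<dots> \<le> c ^ M + (\<Sum>x=n..M. 2 * c ^ M * inverse c ^ x)"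
    unfolding of_nat_add of_nat_sum
  proof (intro add_mono sum_mono)
    fix x assume x: "x \<in> {n..M}"
    then have "real (card (bounded_sum_lists n (M - x))) \<le> 2 * c ^ (M - x)"
      using less.IH[of "M - x"] assms(1) by simp
    with x show "real (card (bounded_sum_lists n (M - x))) \<le> 2 * c ^ M * inverse c ^ x"
      using assms(2) by (simp add: power_diff power_inverse divide_inverse)
  qed (use assms(2) in simp)
  also have "\<dots> = c ^ M + 2 * c ^ M * (\<Sum>x=n..M. inverse c ^ x)"
    by (simp add: sum_distrib_left)
  also have "\<dots> \<le> c ^ M + 2 * c ^ M * (1 / 2)"
    using assms(2) by (intro add_left_mono mult_left_mono tail) auto
  finally show ?case by simp
qed

lemma eventually_card_bounded_sum_lists_le:
  fixes c :: real
  assumes "1 < c"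
  shows "\<forall>\<^sub>F n in sequentially. \<forall>M. card (bounded_sum_lists n M) \<le> 2 * c ^ M"
proof -
  let ?y = "inverse c"
  have y: "0 < ?y" "?y < 1" using assms by (simp_all add: inverse_less_1_iff)
  have "(\<lambda>n. ?y ^ n / (1 - ?y)) \<longlonglongrightarrow> 0 / (1 - ?y)"
    using y by (intro tendsto_intros LIMSEQ_realpow_zero) auto
  then have "\<forall>\<^sub>F n in sequentially. ?y ^ n / (1 - ?y) < 1 / 2"
    by (rule order_tendstoD) simp
  with eventually_ge_at_top[of 1] show ?thesis
  proof eventually_elim
    case (elim n)
    have "(\<Sum>x=n..M. ?y ^ x) \<le> 1 / 2" for M
    proof -
      have "(\<Sum>x=n..M. ?y ^ x) \<le> ?y ^ n / (1 - ?y)"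
        using y by (auto simp: sum_gp divide_right_mono)
      with elim(2) show ?thesis by linarith
    qed
    with elim(1) assms show ?case by (intro allI card_bounded_sum_lists_le)
  qed
qed

subsection \<open>Slow escape and coincidences\<close>

definition slow_escape :: "nat \<Rightarrow> nat \<Rightarrow> (nat \<Rightarrow> letter list) set" where
  "slow_escape d m = {\<omega>. 4 * length (rw_pos (free_group d) \<omega> m) < m}"

definition coincidence :: "nat \<Rightarrow> nat \<Rightarrow> nat \<Rightarrow> nat \<Rightarrow> nat list \<Rightarrow> (nat \<Rightarrow> letter list) set" where
  "coincidence d h i k ms = {\<omega>. h \<le> length (rw_prod (free_group d) \<omega> ms) \<and>
     rw_pos (free_group d) (shift_seq i \<omega>) k = word_inv (take h (rw_prod (free_group d) \<omega> ms))}"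

definition coincidences :: "nat \<Rightarrow> nat \<Rightarrow> nat \<Rightarrow> (nat \<Rightarrow> letter list) set" where
  "coincidences d n m = (let h = m div 64 in
     \<Union>(i, ms) \<in> {8 * h..m} \<times> {ms \<in> bounded_sum_lists n (16 * h). set ms \<subseteq> {..8 * h}}.
       coincidence d h i (m - i) ms)"

lemma coincidences_antimono: "n \<le> n' \<Longrightarrow> coincidences d n' m \<subseteq> coincidences d n m"
  using bounded_sum_lists_antimono[of n n'] by (fastforce simp: coincidences_def Let_def)

subsection \<open>Deterministic paths\<close>

locale letter_path =
  fixes d :: nat and \<omega> :: "nat \<Rightarrow> letter list"
  assumes letter_step: "\<exists>a. fst a < d \<and> \<omega> i = [a]"
begin

abbreviation X :: "nat \<Rightarrow> letter list" where
  "X n \<equiv> rw_pos (free_group d) \<omega> n"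

lemma step_closed: "\<omega> i \<in> carrier (free_group d)"
  using letter_step[of i] by (auto simp: carrier_free_group_iff)

lemma X_Suc_cases:
  obtains a where "X (Suc n) = X n @ [a]" | a where "X n = X (Suc n) @ [a]"
proof -
  obtain a where "\<omega> n = [a]" using letter_step by blast
  then have "X (Suc n) = X n \<odot> [a]" by (simp add: rw_pos_Suc)
  then show ?thesis
    using word_mult_letter_cases[OF reduced_rw_pos[of d \<omega> n], of a] that by metis
qed

lemma length_X_le: "length (X n) \<le> n"
proof (induction n)
  case (Suc n)
  then show ?case by (cases n rule: X_Suc_cases) auto
qed simp

lemma prefix_X_backward:
  assumes "J \<le> m" "prefix p (X m)" "\<And>i. J \<le> i \<Longrightarrow> length p \<le> length (X i)"
  shows "prefix p (X J)"
  using assms(1,2)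
proof (induction m rule: dec_induct)
  case (step m)
  have "prefix p (X m)"
  proof (cases m rule: X_Suc_cases)
    case (1 a)
    then have "prefix (X m) (X (Suc m))" by simp
    then show ?thesis using step assms(3) by (metis prefix_length_prefix)
  next
    case (2 a)
    with step.prems show ?thesis by simp
  qed
  then show ?case by (rule step.IH)
qed simp

lemma X_visits_prefix:
  assumes "J \<le> m" "prefix p (X m)" "length (X J) \<le> length p"
  obtains i where "i \<in> {J..m}" "X i = p"
proof -
  have "\<exists>i\<in>{J..m}. X i = p"
    using assms(1,2)
  proof (induction m rule: dec_induct)
    case base
    with assms(3) show ?case by (auto simp: prefix_def)
  next
    case (step m)
    show ?case
    proof (cases "prefix p (X m)")
      case True
      with step.IH show ?thesis by (auto intro: le_SucI)
    next
      case False
      with step.prems have "X (Suc m) = p" by (cases m rule: X_Suc_cases) auto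
      with step.hyps(1) show ?thesis by (intro bexI[of _ "Suc m"]) auto
    qed
  qed
  then show ?thesis using that by blast
qed

lemma rw_pos_shift_eq_suffix:
  assumes "J \<le> m" "X m = p @ t" "length (X J) \<le> length p"
  obtains i where "i \<in> {J..m}" "rw_pos (free_group d) (shift_seq i \<omega>) (m - i) = t"
proof -
  interpret group "free_group d" by (rule group_free_group)
  let ?S = "\<lambda>i. rw_pos (free_group d) (shift_seq i \<omega>) (m - i)"
  obtain i where i: "i \<in> {J..m}" "X i = p"
    using X_visits_prefix[of J m p] assms by auto
  have closed: "X m \<in> carrier (free_group d)" "?S i \<in> carrier (free_group d)"
    using step_closed by (auto intro!: rw_pos_closed simp: shift_seq_def)
  then have "p \<in> carrier (free_group d)" "t \<in> carrier (free_group d)"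
    using assms(2) by (auto simp: carrier_free_group_iff reduced_word_append_iff)
  moreover have "p \<odot> ?S i = p \<odot> t"
  proof -
    have "p \<odot> ?S i = X m" using rw_pos_add[of \<omega> i "m - i"] step_closed i by simp
    also have "\<dots> = p \<odot> t" using assms(2) reduced_rw_pos by (metis word_mult_eq_append)
    finally show ?thesis .
  qed
  ultimately have "?S i = t" using l_cancel closed(2) by simp
  with i(1) show ?thesis by (rule that)
qed

end

locale escaping_path = letter_path +
  fixes n0 :: nat
  assumes not_slow_escape: "n0 \<le> m \<Longrightarrow> \<omega> \<notin> slow_escape d m"
    and no_coincidences: "n0 \<le> m \<Longrightarrow> \<omega> \<notin> coincidences d n0 m"
begin

abbreviation P :: "nat list \<Rightarrow> letter list" where
  "P ms \<equiv> rw_prod (free_group d) \<omega> ms"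

lemma length_X_ge: "n0 \<le> m \<Longrightarrow> m \<le> 4 * length (X m)"
  using not_slow_escape[of m] by (simp add: slow_escape_def)

lemma rw_pos_shift_neq_word_inv:
  assumes "n0 \<le> m" "i \<in> {8 * (m div 64)..m}" "set ms \<subseteq> {n0..8 * (m div 64)}"
    and "sum_list ms \<le> 16 * (m div 64)" "prefix v (P ms)" "length v = m div 64"
  shows "rw_pos (free_group d) (shift_seq i \<omega>) (m - i) \<noteq> word_inv v"
proof -
  have "(i, ms) \<in> {8 * (m div 64)..m} \<times>
      {ms \<in> bounded_sum_lists n0 (16 * (m div 64)). set ms \<subseteq> {..8 * (m div 64)}}"
    using assms(2-4) by (auto simp: bounded_sum_lists_def)
  then have "\<omega> \<notin> coincidence d (m div 64) i (m - i) ms"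
    using no_coincidences[OF assms(1)] by (auto simp: coincidences_def Let_def)
  moreover have "take (m div 64) (P ms) = v" "m div 64 \<le> length (P ms)"
    using assms(5,6) by (auto simp: prefix_def)
  ultimately show ?thesis by (simp add: coincidence_def)
qed

definition small_cancellation :: "nat list \<Rightarrow> bool" where
  "small_cancellation ms \<longleftrightarrow>
     (\<forall>m v. 64 * n0 \<le> m \<longrightarrow> suffix (word_inv v) (X m) \<longrightarrow> prefix v (P ms)
        \<longrightarrow> length v < m div 64)"

lemma small_cancellationD:
  assumes "small_cancellation ms" "64 * n0 \<le> m" "X m = u @ word_inv v" "P ms = v @ w"
  shows "length v < m div 64"
  using assms unfolding small_cancellation_def by (metis prefixI suffixI)

definition short_prefixes :: "nat list \<Rightarrow> bool" where
  "short_prefixes ms \<longleftrightarrow>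
     (\<forall>h p. n0 \<le> h \<longrightarrow> length p \<le> h \<longrightarrow> prefix p (P ms) \<longrightarrow>
        (\<exists>ns. set ns \<subseteq> {n0..8 * h} \<and> sum_list ns \<le> 8 * h + 8 * length p \<and> prefix p (P ns)))"

lemma small_cancellation_if_short_prefixes:
  assumes "short_prefixes ms"
  shows "small_cancellation ms"
  unfolding small_cancellation_def
proof (intro allI impI, rule ccontr)
  fix m v
  assume m: "64 * n0 \<le> m" and suf: "suffix (word_inv v) (X m)" and pre: "prefix v (P ms)"
    and "\<not> length v < m div 64"
  define h where "h = m div 64"
  define v' where "v' = take h v"
  have h: "n0 \<le> h" "64 * h \<le> m" "length v' = h"
    using m \<open>\<not> length v < m div 64\<close> by (auto simp: h_def v'_def)
  have "prefix v' (P ms)" using pre take_is_prefix prefix_order.trans v'_def by blast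
  then obtain ns where ns: "set ns \<subseteq> {n0..8 * h}" "sum_list ns \<le> 16 * h" "prefix v' (P ns)"
    using assms h unfolding short_prefixes_def by fastforce
  have "v = v' @ drop h v" by (simp add: v'_def)
  then have "suffix (word_inv v') (word_inv v)" by (metis suffixI word_inv_simps(3))
  then obtain t where t: "X m = t @ word_inv v'"
    using suf by (meson suffix_order.trans suffix_def)
  have "length (X (8 * h)) \<le> length t"
    using length_X_le[of "8 * h"] length_X_ge[of m] arg_cong[OF t, of length] m h by simp
  then obtain i where "i \<in> {8 * h..m}"
    "rw_pos (free_group d) (shift_seq i \<omega>) (m - i) = word_inv v'"
    using rw_pos_shift_eq_suffix[OF _ t, of "8 * h"] h by auto
  then show False using rw_pos_shift_neq_word_inv[of m i ns v'] ns m h(3) by (simp add: h_def)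
qed

lemma prefix_X_min:
  assumes "n0 \<le> h" "length p \<le> h" "prefix p (X m)"
  shows "prefix p (X (min m (8 * h)))"
proof (cases "m \<le> 8 * h")
  case False
  have "length p \<le> length (X i)" if "8 * h \<le> i" for i
    using length_X_ge[of i] that assms(1,2) by linarith
  with False assms(3) show ?thesis using prefix_X_backward[of "8 * h" m p] by simp
qed (use assms(3) in simp)

text \<open>A factor \<open>X m\<close> that already contains the prefix may be replaced by \<open>X (8 * h)\<close> if
  \<open>m > 8 * h\<close>, because the first \<open>h\<close> letters have stabilised by then, and everything after such a
  factor is irrelevant. Each earlier factor \<open>X m\<close> lengthens the known prefix by at least
  \<open>m / 8\<close>, since it loses less than \<open>m / 64\<close> of its at least \<open>m / 4\<close> letters; hence the bound on
  the sum.\<close>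

lemma short_prefixes_Cons:
  assumes m: "64 * n0 \<le> m" and sc: "small_cancellation ms" and IH: "short_prefixes ms"
  shows "short_prefixes (m # ms)"
  unfolding short_prefixes_def
proof (intro allI impI)
  fix h p assume h: "n0 \<le> h" "length p \<le> h" and p: "prefix p (P (m # ms))"
  obtain u v w where uvw: "X m = u @ word_inv v" "P ms = v @ w" "P (m # ms) = u @ w"
    using word_mult_cancellation[OF reduced_rw_pos reduced_rw_prod]
    by (metis mult_free_group rw_prod_simps(2))
  have "length v < m div 64"
    using small_cancellationD[OF sc m uvw(1,2)] .
  then have len: "64 * length v \<le> m" "m \<le> 4 * (length u + length v)"
    using length_X_ge[of m] m uvw(1) by simp_all
  consider "prefix p u" | q where "p = u @ q" "prefix q w" "q \<noteq> []"
    using p unfolding uvw(3) prefix_append by (metis append_Nil2 prefix_order.refl)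
  then show "\<exists>ns. set ns \<subseteq> {n0..8 * h} \<and> sum_list ns \<le> 8 * h + 8 * length p \<and> prefix p (P ns)"
  proof cases
    case 1
    then have "prefix p (X (min m (8 * h)))"
      using prefix_X_min h uvw(1) by auto
    then show ?thesis
      using m h by (intro exI[of _ "[min m (8 * h)]"]) (auto simp: word_mult_Nil_right)
  next
    case (2 q)
    have gain: "8 * length (v @ q) + m \<le> 8 * length p" using len 2(1) by simp
    then have "length (v @ q) \<le> h" "prefix (v @ q) (P ms)" using h 2(2) uvw(2) by simp_all
    then obtain ns where ns: "set ns \<subseteq> {n0..8 * h}"
      "sum_list ns \<le> 8 * h + 8 * length (v @ q)" "prefix (v @ q) (P ns)"
      using IH h(1) unfolding short_prefixes_def by blast
    have "reduced_word (u @ word_inv v)" "reduced_word (u @ w)"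
      by (metis uvw(1) reduced_rw_pos, metis uvw(3) reduced_rw_prod)
    then have "prefix (u @ q) (P (m # ns))"
      using prefix_word_mult_cancel[of u v q "P ns"] 2 ns(3) uvw(1)
      by (auto simp: prefix_def reduced_word_append_iff)
    then show ?thesis
      using ns gain m h 2(1) by (intro exI[of _ "m # ns"]) auto
  qed
qed

lemma small_cancellation_if_set_subset:
  assumes "set ms \<subseteq> {64 * n0..}"
  shows "small_cancellation ms"
proof (rule small_cancellation_if_short_prefixes)
  show "short_prefixes ms" using assms
  proof (induction ms)
    case Nil
    show ?case by (auto simp: short_prefixes_def intro: exI[of _ "[]"])
  next
    case (Cons m ms)
    then show ?case by (auto intro: short_prefixes_Cons small_cancellation_if_short_prefixes)
  qed
qed

theorem Nil_notin_rw_tail_semigroup: "[] \<notin> rw_tail_semigroup (free_group d) \<omega> (64 * n0)"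
proof
  interpret group "free_group d" by (rule group_free_group)
  assume "[] \<in> rw_tail_semigroup (free_group d) \<omega> (64 * n0)"
  then obtain ns where "ns \<noteq> []" "set ns \<subseteq> {64 * n0..}" "P ns = []"
    unfolding rw_tail_semigroup_eq_rw_prod[OF step_closed] by force
  then obtain m ms where ms: "set ms \<subseteq> {64 * n0..}" "64 * n0 \<le> m" "X m \<odot> P ms = []"
    by (cases ns) auto
  obtain u v w where uvw: "X m = u @ word_inv v" "P ms = v @ w" "X m \<odot> P ms = u @ w"
    using word_mult_cancellation[OF reduced_rw_pos reduced_rw_prod] by blast
  then have "length v < m div 64"
    using small_cancellationD[OF small_cancellation_if_set_subset[OF ms(1)] ms(2)] by blast
  moreover have "length (X m) = length v" using uvw ms(3) by simp
  ultimately show False using length_X_ge[of m] ms(2) by linarith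
qed

end

subsection \<open>Probability estimates\<close>

lemma mu_free_eq: "mu_free d = pmf_of_set ((\<lambda>a. [a]) ` ({..<d} \<times> UNIV))"
  unfolding mu_free_def by (intro arg_cong[of _ _ pmf_of_set]) auto

lemma set_pmf_mu_free: "0 < d \<Longrightarrow> set_pmf (mu_free d) = (\<lambda>a. [a]) ` ({..<d} \<times> UNIV)"
  unfolding mu_free_eq by (subst set_pmf_of_set) auto

lemma power_length_mult_letter_le:
  fixes t :: real
  assumes "0 < t" "t \<le> 1" and g: "reduced_word g"
  shows "t ^ length (g \<odot> [a])
    \<le> t * t ^ length g + (if a = inv_letter (last g) then (1 / t - t) * t ^ length g else 0)"
proof (rule word_mult_letter_cases[OF g, of a])
  have "t * t \<le> 1" using assms(1,2) by (simp add: mult_le_one)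
  then have "t \<le> 1 / t" using assms(1) by (simp add: pos_le_divide_eq)
  moreover assume "g \<odot> [a] = g @ [a]"
  ultimately show ?thesis using assms(1) by simp
next
  assume "g = g \<odot> [a] @ [inv_letter a]"
  then have "last g = inv_letter a" "length g = Suc (length (g \<odot> [a]))"
    by (metis last_snoc, metis length_append_singleton)
  then show ?thesis using assms(1) by (simp add: algebra_simps)
qed

definition decay_factor :: "nat \<Rightarrow> real \<Rightarrow> real" where
  "decay_factor d t = ((2 * real d - 1) * t + 1 / t) / (2 * real d)"

lemma decay_factor_nonneg: "0 < d \<Longrightarrow> 0 < t \<Longrightarrow> 0 \<le> decay_factor d t"
  by (simp add: decay_factor_def)

text \<open>For \<open>d = 5\<close> the value \<open>1 / 3 = 1 / sqrt (2 * d - 1)\<close> minimises the decay factor.\<close>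

lemma decay_factor_one_third_le:
  assumes "d > 4"
  shows "decay_factor d (1 / 3) \<le> 3 / 5"
proof -
  have "(2 * real d - 1) * (1 / 3) + 1 / (1 / 3) \<le> 3 / 5 * (2 * real d)"
    using assms by (simp add: field_simps)
  then show ?thesis using assms by (simp add: decay_factor_def pos_divide_le_eq)
qed

lemma nn_integral_mu_free_power_length_le:
  fixes t :: real
  assumes "0 < d" "0 < t" "t \<le> 1" and g: "reduced_word g"
  shows "(\<integral>\<^sup>+z. ennreal (t ^ length (g \<odot> z)) \<partial>measure_pmf (mu_free d))
    \<le> ennreal (decay_factor d t * t ^ length g)"
proof -
  let ?A = "(\<lambda>a. [a]) ` ({..<d} \<times> (UNIV :: bool set))" and ?T = "t ^ length g"
  have A: "finite ?A" "card ?A = 2 * d" "?A \<noteq> {}"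
    using assms(1) by (auto simp: card_image inj_on_def card_cartesian_product)
  have nonneg: "0 \<le> (1 / t - t) * ?T"
    using assms(2,3) power_le_one[of t 2]
    by (simp add: power2_eq_square pos_le_divide_eq)
  have "(\<Sum>z\<in>?A. t ^ length (g \<odot> z))
      \<le> (\<Sum>z\<in>?A. t * ?T + (if z = [inv_letter (last g)] then (1 / t - t) * ?T else 0))"
  proof (rule sum_mono)
    fix z assume "z \<in> ?A"
    then obtain a where "z = [a]" by blast
    then show "t ^ length (g \<odot> z)
        \<le> t * ?T + (if z = [inv_letter (last g)] then (1 / t - t) * ?T else 0)"
      using power_length_mult_letter_le[OF assms(2,3) g, of a] by simp
  qed
  also have "\<dots> \<le> real (2 * d) * (t * ?T) + (1 / t - t) * ?T"
    using A(1,2) nonneg by (simp add: sum.distrib)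
  also have "\<dots> = ((2 * real d - 1) * t + 1 / t) * ?T"
    by (simp add: algebra_simps)
  also have "\<dots> = decay_factor d t * ?T * real (2 * d)"
    using assms(1) by (simp add: decay_factor_def)
  finally have "(\<Sum>z\<in>?A. t ^ length (g \<odot> z)) / real (2 * d) \<le> decay_factor d t * ?T"
    using assms(1) by (simp add: pos_divide_le_eq)
  then have "measure_pmf.expectation (mu_free d) (\<lambda>z. t ^ length (g \<odot> z))
      \<le> decay_factor d t * ?T"
    using A unfolding mu_free_eq by (subst integral_pmf_of_set) auto
  moreover have "integrable (mu_free d) (\<lambda>z. t ^ length (g \<odot> z))"
    using A(1) assms(1) by (intro integrable_measure_pmf_finite) (simp add: set_pmf_mu_free)
  ultimately show ?thesis
    using assms(2) by (subst nn_integral_eq_integral) (auto intro: ennreal_leI)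
qed

lemma nn_integral_power_length_rw_pos_le:
  fixes t :: real
  assumes "0 < d" "0 < t" "t \<le> 1" and g: "reduced_word g"
  shows "(\<integral>\<^sup>+\<omega>. ennreal (t ^ length (g \<odot> rw_pos (free_group d) \<omega> k)) \<partial>rw_space (mu_free d))
    \<le> ennreal (decay_factor d t ^ k * t ^ length g)"
proof -
  interpret group "free_group d" by (rule group_free_group)
  have nonneg: "0 \<le> decay_factor d t" using assms(1,2) by (rule decay_factor_nonneg)
  have "(\<integral>\<^sup>+\<omega>. ennreal (t ^ length (g \<odot> rw_pos (free_group d) \<omega> k)) \<partial>rw_space (mu_free d))
      \<le> ennreal (decay_factor d t) ^ k * ennreal (t ^ length (g \<odot> \<one>\<^bsub>free_group d\<^esub>))"
  proof (rule nn_integral_rw_pos_le_power[OF is_monoid])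
    show "set_pmf (mu_free d) \<subseteq> carrier (free_group d)"
      using assms(1) by (auto simp: set_pmf_mu_free carrier_free_group_iff)
    fix x
    have "(\<integral>\<^sup>+z. ennreal (t ^ length ((g \<odot> x) \<odot> z)) \<partial>measure_pmf (mu_free d))
        \<le> ennreal (decay_factor d t * t ^ length (g \<odot> x))"
      by (intro nn_integral_mu_free_power_length_le assms(1-3)) simp
    then show "(\<integral>\<^sup>+z. ennreal (t ^ length (g \<odot> (x \<otimes>\<^bsub>free_group d\<^esub> z))) \<partial>measure_pmf (mu_free d))
        \<le> ennreal (decay_factor d t) * ennreal (t ^ length (g \<odot> x))"
      using nonneg assms(2) by (simp add: word_mult_assoc flip: ennreal_mult)
  qed
  then show ?thesis
    using nonneg assms(2) g by (simp add: word_mult_Nil_right ennreal_mult flip: ennreal_power)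
qed

lemma sets_length_mult_rw_pos_le:
  "{\<omega>. length (g \<odot> rw_pos (free_group d) \<omega> k) \<le> l} \<in> sets (rw_space \<mu>)"
proof -
  have "{\<omega> \<in> space (rw_space \<mu>). length (g \<odot> rw_pos (free_group d) \<omega> k) \<le> l}
      \<in> sets (rw_space \<mu>)"
    by measurable
  then show ?thesis by simp
qed

lemma emeasure_length_mult_rw_pos_le:
  assumes "d > 4" "reduced_word g"
  shows "emeasure (rw_space (mu_free d)) {\<omega>. length (g \<odot> rw_pos (free_group d) \<omega> k) \<le> l}
    \<le> ennreal (3 ^ l * (3 / 5) ^ k * (1 / 3) ^ length g)"
proof -
  let ?M = "rw_space (mu_free d)"
    and ?f = "\<lambda>\<omega>. ennreal ((1 / 3) ^ length (g \<odot> rw_pos (free_group d) \<omega> k))"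
  have [measurable]: "?f \<in> borel_measurable ?M"
    by (rule measurable_compose[OF measurable_rw_pos]) simp
  have "emeasure ?M {\<omega>. length (g \<odot> rw_pos (free_group d) \<omega> k) \<le> l}
      \<le> emeasure ?M {\<omega> \<in> UNIV. 1 \<le> ennreal (3 ^ l) * ?f \<omega>}"
  proof (rule emeasure_mono)
    have "{\<omega> \<in> space ?M. 1 \<le> ennreal (3 ^ l) * ?f \<omega>} \<in> sets ?M" by measurable
    then show "{\<omega> \<in> UNIV. 1 \<le> ennreal (3 ^ l) * ?f \<omega>} \<in> sets ?M" by simp
    have "1 \<le> ennreal (3 ^ l) * ennreal ((1 / 3) ^ n)" if "n \<le> l" for n
      using power_increasing[OF that, of "3 :: real"]
      by (simp add: power_divide flip: ennreal_mult)
    then show "{\<omega>. length (g \<odot> rw_pos (free_group d) \<omega> k) \<le> l}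
        \<subseteq> {\<omega> \<in> UNIV. 1 \<le> ennreal (3 ^ l) * ?f \<omega>}" by auto
  qed
  also have "\<dots> \<le> ennreal (3 ^ l) * (\<integral>\<^sup>+\<omega>. ?f \<omega> * indicator UNIV \<omega> \<partial>?M)"
    using sets.top[of ?M] by (intro nn_integral_Markov_inequality) simp_all
  also have "\<dots> \<le> ennreal (3 ^ l) * ennreal (decay_factor d (1 / 3) ^ k * (1 / 3) ^ length g)"
    using nn_integral_power_length_rw_pos_le[of d "1 / 3" g k] assms by (intro mult_left_mono) auto
  also have "\<dots> \<le> ennreal (3 ^ l * (3 / 5) ^ k * (1 / 3) ^ length g)"
  proof -
    have "decay_factor d (1 / 3) ^ k \<le> (3 / 5) ^ k"
      using assms(1) by (intro power_mono decay_factor_one_third_le decay_factor_nonneg) auto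
    then have "3 ^ l * (decay_factor d (1 / 3) ^ k * (1 / 3) ^ length g)
        \<le> 3 ^ l * (3 / 5) ^ k * (1 / 3) ^ length g"
      by simp
    then show ?thesis by (simp add: ennreal_leI flip: ennreal_mult')
  qed
  finally show ?thesis .
qed

lemma emeasure_rw_pos_eq_le:
  assumes "d > 4"
  shows "emeasure (rw_space (mu_free d)) {\<omega>. rw_pos (free_group d) \<omega> k = r}
    \<le> ennreal ((3 / 5) ^ k * (1 / 3) ^ length r)"
proof (cases "reduced_word r")
  case True
  then have "{\<omega>. rw_pos (free_group d) \<omega> k = r}
      \<subseteq> {\<omega>. length (word_inv r \<odot> rw_pos (free_group d) \<omega> k) \<le> 0}"
    by (auto simp: word_inv_mult_self)
  then have "emeasure (rw_space (mu_free d)) {\<omega>. rw_pos (free_group d) \<omega> k = r}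
      \<le> emeasure (rw_space (mu_free d)) {\<omega>. length (word_inv r \<odot> rw_pos (free_group d) \<omega> k) \<le> 0}"
    by (intro emeasure_mono sets_length_mult_rw_pos_le)
  also have "\<dots> \<le> ennreal ((3 / 5) ^ k * (1 / 3) ^ length r)"
    using emeasure_length_mult_rw_pos_le[of d "word_inv r" k 0] assms True by simp
  finally show ?thesis .
next
  case False
  then have "{\<omega>. rw_pos (free_group d) \<omega> k = r} = {}" using reduced_rw_pos by auto
  then show ?thesis by simp
qed

lemma sets_slow_escape: "slow_escape d m \<in> sets (rw_space \<mu>)"
proof -
  have "{\<omega> \<in> space (rw_space \<mu>). 4 * length (rw_pos (free_group d) \<omega> m) < m} \<in> sets (rw_space \<mu>)"
    by measurable
  then show ?thesis by (simp add: slow_escape_def)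
qed

lemma measure_slow_escape_le:
  assumes "d > 4"
  shows "measure (rw_space (mu_free d)) (slow_escape d m) \<le> (4 / 5) ^ m"
proof -
  have "(3 :: real) ^ (m div 4) \<le> ((4 / 3) ^ 4) ^ (m div 4)"
    by (intro power_mono) (auto simp: power_divide)
  also have "\<dots> \<le> (4 / 3) ^ m" unfolding power_mult[symmetric] by (intro power_increasing) auto
  finally have "(3 :: real) ^ (m div 4) * (3 / 5) ^ m \<le> (4 / 3) ^ m * (3 / 5) ^ m"
    by (rule mult_right_mono) simp
  also have "\<dots> = (4 / 5) ^ m" by (simp flip: power_mult_distrib)
  finally have factor: "(3 :: real) ^ (m div 4) * (3 / 5) ^ m \<le> (4 / 5) ^ m" .
  have "slow_escape d m \<subseteq> {\<omega>. length ([] \<odot> rw_pos (free_group d) \<omega> m) \<le> m div 4}"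
    by (auto simp: slow_escape_def word_mult_Nil_left)
  then have "emeasure (rw_space (mu_free d)) (slow_escape d m)
      \<le> emeasure (rw_space (mu_free d)) {\<omega>. length ([] \<odot> rw_pos (free_group d) \<omega> m) \<le> m div 4}"
    by (intro emeasure_mono sets_length_mult_rw_pos_le)
  also have "\<dots> \<le> ennreal (3 ^ (m div 4) * (3 / 5) ^ m)"
    using emeasure_length_mult_rw_pos_le[OF assms, of "[]"] by simp
  also have "\<dots> \<le> ennreal ((4 / 5) ^ m)" using factor by (rule ennreal_leI)
  finally show ?thesis by (simp add: rw_space.emeasure_eq_measure)
qed

lemma sets_coincidence: "coincidence d h i k ms \<in> sets (rw_space \<mu>)"
proof -
  have "(\<lambda>\<omega>. h \<le> length (rw_prod (free_group d) \<omega> ms) \<and>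
      rw_pos (free_group d) (shift_seq i \<omega>) k = word_inv (take h (rw_prod (free_group d) \<omega> ms)))
      \<in> measurable (rw_space \<mu>) (count_space UNIV)"
    by (intro measurable_count_space_binop[where h = "\<lambda>p y. h \<le> length p \<and> y = word_inv (take h p)"]
        measurable_rw_prod measurable_rw_pos_shift)
  from measurable_sets[OF this, of "{True}"] show ?thesis
    by (simp add: coincidence_def vimage_def)
qed

lemma measure_coincidence_le:
  assumes "d > 4" "set ms \<subseteq> {..i}"
  shows "measure (rw_space (mu_free d)) (coincidence d h i k ms) \<le> (3 / 5) ^ k * (1 / 3) ^ h"
proof -
  define Q where "Q \<omega> \<omega>' \<longleftrightarrow> h \<le> length (rw_prod (free_group d) \<omega> ms) \<and>
     rw_pos (free_group d) \<omega>' k = word_inv (take h (rw_prod (free_group d) \<omega> ms))" for \<omega> \<omega>'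
  have coincidence_eq: "coincidence d h i k ms = {\<omega>. Q \<omega> (shift_seq i \<omega>)}"
    by (simp add: coincidence_def Q_def)
  have "emeasure (rw_space (mu_free d)) {\<omega>. Q \<omega> (shift_seq i \<omega>)}
      \<le> ennreal ((3 / 5) ^ k * (1 / 3) ^ h)"
  proof (rule emeasure_shift_le)
    show "{\<omega>. Q \<omega> (shift_seq i \<omega>)} \<in> sets (rw_space (mu_free d))"
      unfolding coincidence_eq[symmetric] by (rule sets_coincidence)
    show "Q (comb_seq i \<omega> \<omega>') = Q \<omega>" for \<omega> \<omega>'
      by (simp add: Q_def rw_prod_comb_seq[OF assms(2)] fun_eq_iff)
    fix \<omega>
    show "emeasure (rw_space (mu_free d)) {\<omega>'. Q \<omega> \<omega>'} \<le> ennreal ((3 / 5) ^ k * (1 / 3) ^ h)"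
    proof (cases "h \<le> length (rw_prod (free_group d) \<omega> ms)")
      case True
      then show ?thesis
        using emeasure_rw_pos_eq_le[OF assms(1), of k
            "word_inv (take h (rw_prod (free_group d) \<omega> ms))"]
        by (simp add: Q_def)
    qed (simp add: Q_def)
  qed
  then show ?thesis by (simp add: coincidence_eq rw_space.emeasure_eq_measure)
qed

lemma sets_coincidences:
  assumes "1 \<le> n"
  shows "coincidences d n m \<in> sets (rw_space \<mu>)"
  unfolding coincidences_def Let_def
  by (intro sets.finite_UN) (auto simp: finite_bounded_sum_lists[OF assms] intro: sets_coincidence)

lemma sum_power_diff_le:
  fixes c :: real
  assumes "0 \<le> c" "c < 1"
  shows "(\<Sum>i=l..m. c ^ (m - i)) \<le> 1 / (1 - c)"
proof -
  have "(\<Sum>i=l..m. c ^ (m - i)) \<le> (\<Sum>i=0..m. c ^ (m - i))"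
    using assms(1) by (intro sum_mono2) auto
  also have "\<dots> = (\<Sum>i\<le>m. c ^ i)"
    by (subst sum.atLeastAtMost_rev) (simp add: atLeast0AtMost)
  also have "\<dots> \<le> 1 / (1 - c)"
    using assms by (simp add: sum_gp0 divide_right_mono)
  finally show ?thesis .
qed

lemma measure_coincidences_le:
  assumes "d > 4" "1 \<le> n"
    and "card (bounded_sum_lists n (16 * (m div 64))) \<le> 2 * (2 :: real) ^ (m div 64)"
  shows "measure (rw_space (mu_free d)) (coincidences d n m) \<le> 5 * (2 / 3) ^ (m div 64)"
proof -
  define h where "h = m div 64"
  let ?L = "{ms \<in> bounded_sum_lists n (16 * h). set ms \<subseteq> {..8 * h}}"
    and ?prob = "measure (rw_space (mu_free d))"
  have fin: "finite (bounded_sum_lists n (16 * h))" by (rule finite_bounded_sum_lists[OF assms(2)])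
  then have "card ?L \<le> card (bounded_sum_lists n (16 * h))" by (intro card_mono) auto
  then have card_L: "card ?L \<le> 2 * (2 :: real) ^ h" using assms(3) by (simp add: h_def)
  have "?prob (coincidences d n m)
      \<le> (\<Sum>p\<in>{8 * h..m} \<times> ?L. ?prob (case p of (i, ms) \<Rightarrow> coincidence d h i (m - i) ms))"
    unfolding coincidences_def Let_def h_def[symmetric] using fin
    by (intro rw_space.finite_measure_subadditive_finite) (auto intro: sets_coincidence)
  also have "\<dots> \<le> (\<Sum>p\<in>{8 * h..m} \<times> ?L. (3 / 5) ^ (m - fst p) * (1 / 3) ^ h)"
  proof (intro sum_mono)
    fix p assume "p \<in> {8 * h..m} \<times> ?L"
    then have "set (snd p) \<subseteq> {..fst p}" by auto
    then show "?prob (case p of (i, ms) \<Rightarrow> coincidence d h i (m - i) ms)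
        \<le> (3 / 5) ^ (m - fst p) * (1 / 3) ^ h"
      using measure_coincidence_le[OF assms(1)] by (auto simp: split_beta)
  qed
  also have "\<dots> = (\<Sum>i=8 * h..m. (3 / 5) ^ (m - i)) * (card ?L * (1 / 3) ^ h)"
    by (simp add: sum.cartesian_product' sum_distrib_right sum_distrib_left mult_ac)
  also have "\<dots> \<le> 5 / 2 * (2 * 2 ^ h * (1 / 3) ^ h)"
    using sum_power_diff_le[of "3 / 5" m "8 * h"] card_L by (intro mult_mono mult_right_mono) auto
  also have "\<dots> = 5 * (2 / 3) ^ h" by (simp add: power_divide)
  finally show ?thesis by (simp add: h_def)
qed

lemma summable_power_div:
  fixes c :: real
  assumes "0 < c" "c < 1" "0 < k"
  shows "summable (\<lambda>m. c ^ (m div k))"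
proof (rule summable_comparison_test')
  define y where "y = root k c"
  have y: "0 < y" "y < 1" "y ^ k = c" using assms by (auto simp: y_def)
  show "summable (\<lambda>m. y ^ m / c)" using y by (intro summable_divide summable_geometric) auto
  fix m :: nat
  have "m \<le> k * (m div k) + k"
    using assms(3) mod_less_divisor[of k m] mult_div_mod_eq[of k m] by linarith
  then have "y ^ (k * (m div k) + k) \<le> y ^ m" using y by (intro power_decreasing) auto
  then have "c ^ (m div k) * c \<le> y ^ m" by (simp only: power_add power_mult y(3))
  then show "norm (c ^ (m div k)) \<le> y ^ m / c" using assms(1) by (simp add: pos_le_divide_eq)
qed

lemma AE_eventually_fast_escape_no_coincidences:
  assumes "d > 4"
  obtains n where "AE \<omega> in rw_space (mu_free d).
    \<forall>\<^sub>F m in sequentially. \<omega> \<notin> slow_escape d m \<and> \<omega> \<notin> coincidences d n m"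
proof -
  let ?M = "rw_space (mu_free d)"
  have root: "1 < root 16 (2 :: real)" "root 16 (2 :: real) ^ 16 = 2" by simp_all
  obtain n where n: "1 \<le> n" "\<And>M. card (bounded_sum_lists n M) \<le> 2 * root 16 2 ^ M"
    using eventually_conj[OF eventually_ge_at_top[of 1]
        eventually_card_bounded_sum_lists_le[OF root(1)]]
    by (auto simp: eventually_sequentially)
  have card: "card (bounded_sum_lists n (16 * h)) \<le> 2 * (2 :: real) ^ h" for h
    using n(2)[of "16 * h"] by (simp only: power_mult root(2))
  define bad where "bad m = slow_escape d m \<union> coincidences d n m" for m
  have sets_bad: "bad m \<in> sets ?M" for m
    unfolding bad_def by (intro sets.Un sets_slow_escape sets_coincidences n(1))
  have bound: "measure ?M (bad m) \<le> (4 / 5) ^ m + 5 * (2 / 3) ^ (m div 64)" for m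
  proof -
    have "measure ?M (bad m) \<le> measure ?M (slow_escape d m) + measure ?M (coincidences d n m)"
      unfolding bad_def by (intro measure_Un_le sets_slow_escape sets_coincidences n(1))
    also have "\<dots> \<le> (4 / 5) ^ m + 5 * (2 / 3) ^ (m div 64)"
      by (intro add_mono measure_slow_escape_le measure_coincidences_le assms n(1) card)
    finally show ?thesis .
  qed
  have "summable (\<lambda>m. (4 / 5) ^ m + 5 * (2 / 3 :: real) ^ (m div 64))"
    by (intro summable_add summable_mult summable_geometric summable_power_div) auto
  then have "summable (\<lambda>m. measure ?M (bad m))"
    by (rule summable_comparison_test') (use bound in simp)
  then have "AE \<omega> in ?M. \<forall>\<^sub>F m in sequentially. \<omega> \<in> space ?M - bad m"
    by (intro borel_cantelli_AE1 sets_bad) (simp_all add: rw_space.emeasure_eq_measure)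
  then show ?thesis by (intro that[of n]) (simp add: bad_def)
qed

lemma AE_escaping_path:
  assumes "d > 4"
  shows "AE \<omega> in rw_space (mu_free d). \<exists>n\<ge>1. escaping_path d \<omega> n"
proof -
  obtain n where "AE \<omega> in rw_space (mu_free d).
      \<forall>\<^sub>F m in sequentially. \<omega> \<notin> slow_escape d m \<and> \<omega> \<notin> coincidences d n m"
    using AE_eventually_fast_escape_no_coincidences[OF assms] .
  then show ?thesis
    using AE_rw_space_set_pmf[of "mu_free d"]
  proof eventually_elim
    case (elim \<omega>)
    then obtain K where K: "\<And>m. K \<le> m \<Longrightarrow> \<omega> \<notin> slow_escape d m \<and> \<omega> \<notin> coincidences d n m"
      by (auto simp: eventually_sequentially)
    have "escaping_path d \<omega> (max 1 (max n K))"
    proof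
      show "\<exists>a. fst a < d \<and> \<omega> i = [a]" for i
        using elim(2)[rule_format, of i] assms by (auto simp: set_pmf_mu_free)
      fix m assume m: "max 1 (max n K) \<le> m"
      show "\<omega> \<notin> slow_escape d m" using K m by simp
      show "\<omega> \<notin> coincidences d (max 1 (max n K)) m"
        using K[of m] m coincidences_antimono[of n "max 1 (max n K)"] by fastforce
    qed
    then show ?case by (intro exI[of _ "max 1 (max n K)"]) simp
  qed
qed

theorem AE_Nil_notin_rw_tail_semigroup:
  assumes "d > 4"
  shows "AE \<omega> in rw_space (mu_free d). \<exists>n\<ge>1. [] \<notin> rw_tail_semigroup (free_group d) \<omega> n"
  using AE_escaping_path[OF assms]
proof eventually_elim
  case (elim \<omega>)
  then obtain n where "n \<ge> 1" "escaping_path d \<omega> n" by blast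
  then show ?case
    using escaping_path.Nil_notin_rw_tail_semigroup by (intro exI[of _ "64 * n"]) simp
qed

theorem mainTheorem11:
  fixes d :: nat
  assumes "d > 4"
  shows "\<not> alg_recurrent (free_group d) (mu_free d)"
proof
  interpret group "free_group d" by (rule group_free_group)
  assume "alg_recurrent (free_group d) (mu_free d)"
  then have "AE \<omega> in rw_space (mu_free d).
      \<forall>n\<in>{1..}. rw_tail_semigroup (free_group d) \<omega> n = carrier (free_group d)"
    by (simp add: alg_recurrent_def AE_ball_countable)
  with AE_Nil_notin_rw_tail_semigroup[OF assms] have "AE \<omega> in rw_space (mu_free d). False"
  proof eventually_elim
    case (elim \<omega>)
    then show ?case using one_closed by auto
  qed
  then show False by simp
qed

end
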